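(* Let $k$ be a commutative ring containing $1/2$, let $\mathcal{A}$ be an associative $k$-algebra, $M$ an $\mathcal{A}$-bimodule, and $\pi:M\to\mathcal{A}$ a $k$-linear map. Then $\pi$ is a generalized Rota-Baxter operator if and only if it is a solution of $$\frac{1}{2}[\hat{\pi},\hat{\pi}]_{\hat{\mu}}=0 .$$
   Context: Algebras are not necessarily unital. A $k$-linear map $\pi:M\to\mathcal{A}$ is a generalized Rota-Baxter operator (GRB-operator) if $\pi(m)\pi(n)=\pi(\pi(m)\cdot n+m\cdot\pi(n))$ for all $m,n\in M$. The lift of $\pi$ is the endomorphism $\hat{\pi}$ of $\mathcal{A}\oplus M$ given by $\hat{\pi}(a,m):=(\pi(m),0)$. The bilinear map $\hat{\mu}$ on $\mathcal{A}\oplus M$ is the semidirect product multiplication $\hat{\mu}((a,m),(b,n)):=(ab,\,a\cdot n+m\cdot b)$. Gerstenhaber bracket: for a $k$-module $B$ (here $B=\mathcal{A}\oplus M$) let $G(B):=\bigoplus_{n\ge1}\mathrm{Hom}_k(B^{\otimes n},B)$. For $f\in\mathrm{Hom}_k(B^{\otimes m},B)$ and $g\in\mathrm{Hom}_k(B^{\otimes n},B)$ set $f\bar{\circ}g:=\sum_{i=1}^m(-1)^{(i-1)(n-1)}f\circ_i g$, where $(f\circ_i g)(b_1,\dots,b_{m+n-1})=f(b_1,\dots,b_{i-1},g(b_i,\dots,b_{i+n-1}),b_{i+n},\dots,b_{m+n-1})$, and $[f,g]:=f\bar{\circ}g-(-1)^{(m-1)(n-1)}g\bar{\circ}f$. The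 derived bracket is $[f,g]_{\hat{\mu}}:=[[\hat{\mu},f],g]$. *)

theory Defs
  imports "HOL-Analysis.Product_Vector"
begin

text \<open>
  Modules over the commutative ring \<open>'k\<close> are given, as in \<^theory>\<open>HOL.Modules\<close>, by their scalar
  multiplications.  The class \<^class>\<open>ring\<close> provides an associative multiplication without
  requiring a unit.
\<close>

locale assoc_algebra = module scaleA
  for scaleA :: "'k::comm_ring_1 \<Rightarrow> 'a::ring \<Rightarrow> 'a" +
  assumes scale_mult_left: "scaleA c x * y = scaleA c (x * y)"
    and scale_mult_right: "x * scaleA c y = scaleA c (x * y)"

locale bimodule = A: assoc_algebra scaleA + M: module scaleM
  for scaleA :: "'k::comm_ring_1 \<Rightarrow> 'a::ring \<Rightarrow> 'a"
    and scaleM :: "'k \<Rightarrow> 'm::ab_group_add \<Rightarrow> 'm" +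
  fixes lact :: "'a \<Rightarrow> 'm \<Rightarrow> 'm"
    and ract :: "'m \<Rightarrow> 'a \<Rightarrow> 'm"
  assumes lact_linear_left: "module_hom scaleA scaleM (\<lambda>a. lact a m)"
    and lact_linear_right: "module_hom scaleM scaleM (\<lambda>m. lact a m)"
    and ract_linear_left: "module_hom scaleM scaleM (\<lambda>m. ract m a)"
    and ract_linear_right: "module_hom scaleA scaleM (\<lambda>a. ract m a)"
    and lact_mult: "lact (a * b) m = lact a (lact b m)"
    and ract_mult: "ract m (a * b) = ract (ract m a) b"
    and lact_ract: "ract (lact a m) b = lact a (ract m b)"

definition GRB_operator ::
  "('k::comm_ring_1 \<Rightarrow> 'a::ring \<Rightarrow> 'a) \<Rightarrow> ('k \<Rightarrow> 'm::ab_group_add \<Rightarrow> 'm) \<Rightarrow>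
   ('a \<Rightarrow> 'm \<Rightarrow> 'm) \<Rightarrow> ('m \<Rightarrow> 'a \<Rightarrow> 'm) \<Rightarrow> ('m \<Rightarrow> 'a) \<Rightarrow> bool" where
  "GRB_operator scaleA scaleM lact ract \<pi> \<longleftrightarrow>
     module_hom scaleM scaleA \<pi> \<and>
     (\<forall>m n. \<pi> m * \<pi> n = \<pi> (lact (\<pi> m) n + ract m (\<pi> n)))"

text \<open>
  An element of \<open>Hom(B\<^sup>\<otimes>\<^sup>n, B)\<close> is represented by the corresponding \<open>n\<close>-fold multilinear map, as a
  function on lists of length \<open>n\<close>.  It is set to \<open>0\<close> on lists of any other length, so that
  equality of cochains is equality of functions.
\<close>

definition cochains ::
  "('k::comm_ring_1 \<Rightarrow> 'b::ab_group_add \<Rightarrow> 'b) \<Rightarrow> nat \<Rightarrow> ('b list \<Rightarrow> 'b) set" where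
  "cochains s n = {f. (\<forall>bs. length bs \<noteq> n \<longrightarrow> f bs = 0) \<and>
     (\<forall>us vs. length us + 1 + length vs = n \<longrightarrow> module_hom s s (\<lambda>b. f (us @ b # vs)))}"

definition cochain1 :: "('b \<Rightarrow> 'b::ab_group_add) \<Rightarrow> 'b list \<Rightarrow> 'b" where
  "cochain1 f bs = (case bs of [x] \<Rightarrow> f x | _ \<Rightarrow> 0)"

definition cochain2 :: "('b \<Rightarrow> 'b \<Rightarrow> 'b::ab_group_add) \<Rightarrow> 'b list \<Rightarrow> 'b" where
  "cochain2 f bs = (case bs of [x, y] \<Rightarrow> f x y | _ \<Rightarrow> 0)"

text \<open>
  In the following operations the numbers \<open>m, n \<ge> 1\<close> are the arities of \<open>f\<close> and \<open>g\<close>; positions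
  \<open>i\<close> are counted from \<open>1\<close>.
\<close>

definition partial_comp ::
  "nat \<Rightarrow> nat \<Rightarrow> nat \<Rightarrow> ('b list \<Rightarrow> 'b::ab_group_add) \<Rightarrow> ('b list \<Rightarrow> 'b) \<Rightarrow> 'b list \<Rightarrow> 'b" where
  "partial_comp i m n f g bs =
     (if length bs = m + n - 1
      then f (take (i - 1) bs @ g (take n (drop (i - 1) bs)) # drop (i - 1 + n) bs)
      else 0)"

definition circ_bar ::
  "('k::comm_ring_1 \<Rightarrow> 'b::ab_group_add \<Rightarrow> 'b) \<Rightarrow> nat \<Rightarrow> nat \<Rightarrow>
   ('b list \<Rightarrow> 'b) \<Rightarrow> ('b list \<Rightarrow> 'b) \<Rightarrow> 'b list \<Rightarrow> 'b" where
  "circ_bar s m n f g bs =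
     (\<Sum>i = 1..m. s ((-1) ^ ((i - 1) * (n - 1))) (partial_comp i m n f g bs))"

definition gerstenhaber_bracket ::
  "('k::comm_ring_1 \<Rightarrow> 'b::ab_group_add \<Rightarrow> 'b) \<Rightarrow> nat \<Rightarrow> nat \<Rightarrow>
   ('b list \<Rightarrow> 'b) \<Rightarrow> ('b list \<Rightarrow> 'b) \<Rightarrow> 'b list \<Rightarrow> 'b" where
  "gerstenhaber_bracket s m n f g bs =
     circ_bar s m n f g bs - s ((-1) ^ ((m - 1) * (n - 1))) (circ_bar s n m g f bs)"

text \<open>Here \<open>\<mu>\<close> has arity \<open>2\<close>, so the inner bracket has arity \<open>m + 1\<close>.\<close>

definition derived_bracket ::
  "('k::comm_ring_1 \<Rightarrow> 'b::ab_group_add \<Rightarrow> 'b) \<Rightarrow> ('b list \<Rightarrow> 'b) \<Rightarrow> nat \<Rightarrow> nat \<Rightarrow>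
   ('b list \<Rightarrow> 'b) \<Rightarrow> ('b list \<Rightarrow> 'b) \<Rightarrow> 'b list \<Rightarrow> 'b" where
  "derived_bracket s \<mu> m n f g =
     gerstenhaber_bracket s (m + 1) n (gerstenhaber_bracket s 2 m \<mu> f) g"

definition lift :: "('m::ab_group_add \<Rightarrow> 'a::ab_group_add) \<Rightarrow> ('a \<times> 'm) list \<Rightarrow> 'a \<times> 'm" where
  "lift \<pi> = cochain1 (\<lambda>(a, m). (\<pi> m, 0))"

definition semidirect_mult ::
  "('a::ring \<Rightarrow> 'm::ab_group_add \<Rightarrow> 'm) \<Rightarrow> ('m \<Rightarrow> 'a \<Rightarrow> 'm) \<Rightarrow> ('a \<times> 'm) list \<Rightarrow> 'a \<times> 'm" where
  "semidirect_mult lact ract = cochain2 (\<lambda>(a, m) (b, n). (a * b, lact a n + ract m b))"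

lemma (in module) module_hom_scale_cochain:
  "module_hom scale scale f \<Longrightarrow> module_hom scale scale (\<lambda>b. scale c (f b))"
  by (auto simp: module_hom_iff scale_right_distrib mult.commute)

lemma partial_comp_in_cochains:
  assumes s: "module s" and f: "f \<in> cochains s m" and g: "g \<in> cochains s n"
    and i: "1 \<le> i" "i \<le> m"
  shows "partial_comp i m n f g \<in> cochains s (m + n - 1)"
  unfolding cochains_def
proof (safe, goal_cases)
  case (1 bs)
  then show ?case by (simp add: partial_comp_def)
next
  case (2 us vs)
  have fl: "module_hom s s (\<lambda>b. f (us @ b # vs))" if "length us + 1 + length vs = m" for us vs
    using f that unfolding cochains_def by blast
  have gl: "module_hom s s (\<lambda>b. g (us @ b # vs))" if "length us + 1 + length vs = n" for us vs
    using g that unfolding cochains_def by blast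
  have len: "length us + 1 + length vs = m + n - 1" by (fact 2)
  consider (a) "length us < i - 1" | (b) "i - 1 \<le> length us" "length us < i - 1 + n"
    | (c) "i - 1 + n \<le> length us" by linarith
  then show ?case
  proof cases
    case a
    define p where "p = i - 2 - length us"
    have i_eq: "i = Suc (Suc (length us + p))" using a by (simp add: p_def)
    have eq: "partial_comp i m n f g (us @ b # vs) =
      f (us @ b # (take p vs @ g (take n (drop p vs)) # drop (p + n) vs))" for b
      using len by (simp add: partial_comp_def i_eq)
    show ?thesis unfolding eq
      using a len i by (intro fl) (simp add: p_def)
  next
    case b
    define k where "k = i - 1"
    define q where "q = n - 1 - (length us - k)"
    have q: "n - (length us - k) = Suc q" "k + n - length us = Suc q"
      using b by (simp_all add: k_def q_def)
    have z: "k - length us = 0" using b by (simp add: k_def)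
    have eq: "partial_comp i m n f g (us @ b # vs) =
      f (take k us @ g (drop k us @ b # take q vs) # drop q vs)" for b
      using b len unfolding partial_comp_def k_def[symmetric] by (simp add: q z)
    have h1: "module_hom s s (\<lambda>b. g (drop k us @ b # take q vs))"
      using b len i by (intro gl) (simp add: k_def q_def)
    have h2: "module_hom s s (\<lambda>b. f (take k us @ b # drop q vs))"
      using b len i by (intro fl) (simp add: k_def q_def)
    show ?thesis unfolding eq
      using module_hom_compose[OF h1 h2] by (simp add: o_def)
  next
    case c
    have z: "i - 1 - length us = 0" "i - Suc (length us) = 0" "i - 1 + n - length us = 0"
      "i - Suc 0 - length us = 0" "i - Suc 0 + n - length us = 0"
      "n - (length us - (i - Suc 0)) = 0"
      using c by simp_all
    have eq: "partial_comp i m n f g (us @ b # vs) =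
      f ((take (i - 1) us @ g (take n (drop (i - 1) us)) # drop (i - 1 + n) us) @ b # vs)" for b
      using c len by (simp add: partial_comp_def z)
    show ?thesis unfolding eq
      using c len i by (intro fl) simp
  qed
qed

lemma circ_bar_in_cochains:
  assumes s: "module s" and f: "f \<in> cochains s m" and g: "g \<in> cochains s n"
  shows "circ_bar s m n f g \<in> cochains s (m + n - 1)"
proof -
  interpret module s by (fact s)
  have pc: "partial_comp i m n f g \<in> cochains s (m + n - 1)" if "i \<in> {1..m}" for i
    using partial_comp_in_cochains[OF s f g] that by simp
  show ?thesis
    unfolding cochains_def circ_bar_def
  proof (safe, goal_cases)
    case (1 bs)
    then show ?case by (simp add: partial_comp_def)
  next
    case (2 us vs)
    then have "module_hom s s (\<lambda>b. partial_comp i m n f g (us @ b # vs))" if "i \<in> {1..m}" for i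
      using pc[OF that] unfolding cochains_def by blast
    then show ?case
      by (auto simp: module_hom_iff scale_right_distrib scale_sum_right sum.distrib
          mult.commute s intro!: sum.cong)
  qed
qed

lemma gerstenhaber_bracket_in_cochains:
  assumes s: "module s" and f: "f \<in> cochains s m" and g: "g \<in> cochains s n"
  shows "gerstenhaber_bracket s m n f g \<in> cochains s (m + n - 1)"
proof -
  interpret module s by (fact s)
  have 1: "circ_bar s m n f g \<in> cochains s (m + n - 1)"
    by (rule circ_bar_in_cochains[OF s f g])
  have 2: "circ_bar s n m g f \<in> cochains s (m + n - 1)"
    using circ_bar_in_cochains[OF s g f] by (simp add: add.commute)
  show ?thesis
    using 1 2 unfolding cochains_def gerstenhaber_bracket_def
    by (auto simp: module_hom_iff scale_right_distrib scale_right_diff_distrib mult.commute)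
qed

lemma (in bimodule) module_prod_scale: "module_prod scaleA scaleM"
  by unfold_locales

lemma (in bimodule) lift_in_cochains:
  assumes "module_hom scaleM scaleA \<pi>"
  shows "lift \<pi> \<in> cochains (module_prod.scale scaleA scaleM) 1"
proof -
  interpret P: module_prod scaleA scaleM by (rule module_prod_scale)
  interpret pi: module_hom scaleM scaleA \<pi> by (fact assms)
  show ?thesis
    by (auto simp: cochains_def lift_def cochain1_def module_hom_iff P.p.module_axioms
        P.scale_def pi.add pi.scale split: list.splits)
qed

lemma (in bimodule) semidirect_mult_in_cochains:
  "semidirect_mult lact ract \<in> cochains (module_prod.scale scaleA scaleM) 2"
proof -
  interpret P: module_prod scaleA scaleM by (rule module_prod_scale)
  have D: "length us + 1 + length vs = 2 \<Longrightarrow>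
      (\<exists>x. us = [] \<and> vs = [x]) \<or> (\<exists>x. us = [x] \<and> vs = [])"
    for us vs :: "('a \<times> 'm) list"
    by (cases us; cases vs) auto
  have L: "module_hom (module_prod.scale scaleA scaleM) (module_prod.scale scaleA scaleM)
      (\<lambda>b. semidirect_mult lact ract (us @ b # vs))"
    if "length us + 1 + length vs = 2" for us vs
    using D[OF that] lact_linear_left lact_linear_right ract_linear_left ract_linear_right
    by (auto simp: semidirect_mult_def cochain2_def module_hom_iff P.p.module_axioms P.scale_def
        algebra_simps A.scale_mult_left A.scale_mult_right split: prod.splits)
  show ?thesis
    unfolding cochains_def using L
    by (auto simp: semidirect_mult_def cochain2_def split: list.splits)
qed

end

theory Submission
  imports Defs
begin

text \<open>
  The derived bracket is the commutator of \<open>\<mu>\<close> with \<open>\<pi>\<close> taken twice.  As the lift of \<open>\<pi>\<close> has square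
  zero, only the mixed terms survive and each occurs twice:
  the bracket is \<open>2 (\<pi> m \<pi> n - \<pi> (\<pi> m \<cdot> n + m \<cdot> \<pi> n), 0)\<close> at \<open>(a, m), (b, n)\<close>.
\<close>

lemma cochain2_eq_zero_iff:
  "cochain2 f = (\<lambda>bs. 0) \<longleftrightarrow> (\<forall>x y. f x y = 0)"
proof
  assume "cochain2 f = (\<lambda>bs. 0)"
  then have "cochain2 f [x, y] = 0" for x y by simp
  then show "\<forall>x y. f x y = 0" by (simp add: cochain2_def)
qed (auto simp: cochain2_def fun_eq_iff split: list.splits)

text \<open>Every sign is trivial, since one arity is 1 and each exponent contains the factor 1 - 1.
  The result is again a \<open>cochain2\<close>, so the formula can be iterated to compute a derived
  bracket.\<close>

lemma (in module) gerstenhaber_bracket_cochain2_cochain1: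
  "gerstenhaber_bracket scale 2 1 (cochain2 f) (cochain1 g) =
     cochain2 (\<lambda>x y. f (g x) y + f x (g y) - g (f x y))"
proof
  fix bs
  show "gerstenhaber_bracket scale 2 1 (cochain2 f) (cochain1 g) bs =
     cochain2 (\<lambda>x y. f (g x) y + f x (g y) - g (f x y)) bs"
  proof (cases "length bs = 2")
    case True
    then obtain x y where "bs = [x, y]"
      by (auto simp: length_Suc_conv numeral_2_eq_2)
    then show ?thesis
      by (simp add: gerstenhaber_bracket_def circ_bar_def partial_comp_def
          cochain1_def cochain2_def numeral_2_eq_2)
  next
    \<comment> \<open>Either order of composition has arity 2 + 1 - 1 = 2, so both sides take their
      default value 0.\<close>
    case False
    then show ?thesis
      by (auto simp: gerstenhaber_bracket_def circ_bar_def partial_comp_def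
          cochain2_def split: list.splits)
  qed
qed

text \<open>With P the lifted endomorphism and \<mu> the semidirect product, P P = 0 removes \<mu>(P
  P x, y), \<mu>(x, P P y) and P P \<mu>(x, y). What remains is \<mu>(P x, P y) - P \<mu>(P x, y) -
  P \<mu>(x, P y), twice.\<close>

lemma (in bimodule) derived_bracket_lift:
  assumes "module_hom scaleM scaleA \<pi>"
  shows "derived_bracket (module_prod.scale scaleA scaleM) (semidirect_mult lact ract) 1 1
      (lift \<pi>) (lift \<pi>) =
    cochain2 (\<lambda>(a, m) (b, n).
      (let d = \<pi> m * \<pi> n - \<pi> (lact (\<pi> m) n + ract m (\<pi> n)) in (d + d, 0)))"
proof -
  interpret P: module_prod scaleA scaleM by (rule module_prod_scale)
  interpret pi: module_hom scaleM scaleA \<pi> by (fact assms)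
  \<comment> \<open>Linearity in each argument makes the actions vanish at 0, which disposes of the
    zero components produced by the lift.\<close>
  interpret lact_left: module_hom scaleA scaleM "\<lambda>a. lact a m" for m by (fact lact_linear_left)
  interpret lact_right: module_hom scaleM scaleM "lact a" for a by (fact lact_linear_right)
  interpret ract_left: module_hom scaleM scaleM "\<lambda>m. ract m a" for a by (fact ract_linear_left)
  interpret ract_right: module_hom scaleA scaleM "ract m" for m by (fact ract_linear_right)
  show ?thesis
    \<comment> \<open>\<open>one_add_one\<close> turns the arity 1 + 1 of the inner bracket into the
      literal 2, so that the bracket formula also applies to the outer bracket.\<close>
    unfolding derived_bracket_def semidirect_mult_def lift_def one_add_one
      P.p.gerstenhaber_bracket_cochain2_cochain1
    by (rule arg_cong[where f = cochain2])
      (auto simp: fun_eq_iff Let_def pi.add pi.diff)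
qed

theorem proposition2p15:
  fixes scaleA :: "'k::comm_ring_1 \<Rightarrow> 'a::ring \<Rightarrow> 'a"
    and scaleM :: "'k \<Rightarrow> 'm::ab_group_add \<Rightarrow> 'm"
    and lact :: "'a \<Rightarrow> 'm \<Rightarrow> 'm"
    and ract :: "'m \<Rightarrow> 'a \<Rightarrow> 'm"
    and \<pi> :: "'m \<Rightarrow> 'a"
    and half :: 'k
  assumes half: "2 * half = 1"
    and bimodule: "bimodule scaleA scaleM lact ract"
    and linear: "module_hom scaleM scaleA \<pi>"
  shows "GRB_operator scaleA scaleM lact ract \<pi> \<longleftrightarrow>
    (\<lambda>bs. module_prod.scale scaleA scaleM half
       (derived_bracket (module_prod.scale scaleA scaleM) (semidirect_mult lact ract) 1 1
          (lift \<pi>) (lift \<pi>) bs)) = (\<lambda>bs. 0)"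
proof -
  interpret bimodule scaleA scaleM lact ract by (fact bimodule)
  interpret P: module_prod scaleA scaleM by (rule module_prod_scale)
  have half_double: "scaleA half (d + d) = d" for d
  proof -
    have "scaleA half (d + d) = scaleA (2 * half) d"
      by (simp only: A.scale_right_distrib A.scale_left_distrib mult_2)
    then show ?thesis by (simp add: half)
  qed
  let ?d = "\<lambda>m n. \<pi> m * \<pi> n - \<pi> (lact (\<pi> m) n + ract m (\<pi> n))"
  have "(\<lambda>bs. P.scale half
       (derived_bracket P.scale (semidirect_mult lact ract) 1 1 (lift \<pi>) (lift \<pi>) bs)) =
      cochain2 (\<lambda>(a, m) (b, n). (?d m n, 0))"
    unfolding derived_bracket_lift[OF linear]
    by (auto simp: fun_eq_iff cochain2_def Let_def P.scale_def half_double zero_prod_def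
        split: list.splits)
  \<comment> \<open>The cochain depends only on the M-components of its arguments, so its vanishing
    is the identity for all m and n; the linearity conjunct of \<open>GRB_operator\<close> is the
    hypothesis \<open>linear\<close>.\<close>
  then show ?thesis
    using linear by (auto simp: GRB_operator_def cochain2_eq_zero_iff prod_eq_iff)
qed

end
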